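(* For every ordinal $\xi$ and every $A\in\mathbb W_\xi$, $o_\xi(A)=\check o_\xi(A)$.
   Context: Formulas of the Reflection Calculus $\mathsf{RC}$ are given by $\phi ::= \top \mid \phi\wedge\psi \mid \alpha\phi$ with $\alpha$ any ordinal ($\alpha\phi$ is also written $\langle\alpha\rangle\phi$). We write $\phi\vdash\psi$ if this sequent is derivable from: $\phi\vdash\phi$; $\phi\vdash\top$; $\phi\wedge\psi\vdash\phi$; $\phi\wedge\psi\vdash\psi$; $\alpha\alpha\phi\vdash\alpha\phi$; $\beta\phi\vdash\alpha\phi$ and $\beta\phi\wedge\alpha\psi\vdash\beta(\phi\wedge\alpha\psi)$ for $\alpha<\beta$; with the rules: from $\phi\vdash\psi$ and $\psi\vdash\chi$ infer $\phi\vdash\chi$; from $\phi\vdash\psi$ and $\phi\vdash\chi$ infer $\phi\vdash\psi\wedge\chi$; from $\phi\vdash\psi$ infer $\alpha\phi\vdash\alpha\psi$. (The polymodal provability logic $\mathsf{GLP}$ is conservative over $\mathsf{RC}$, so equivalently $\mathsf{GLP}\vdash\phi\to\psi$.) Worms: $\mathbb W$ is the least class containing $\top$ and closed under $A\mapsto\langle\alpha\rangle A$ for each ordinal $\alpha$; $\mathbb W_\xi$ is the class of worms all of whose modalities are $\geq\xi$. $A<_\xi B$ iff $B\vdash\langle\xi\rangle A$; this relation is well-founded on $\mathbb W$. Define $o_\xi(A):=\sup\{o_\xi(B)+1: B\in\mathbb W,\ B<_\xi A\}$ for $A\in\mathbb W$, and $\check o_\xi(A):=\sup\{\check o_\xi(B)+1: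 B\in\mathbb W_\xi,\ B<_\xi A\}$ for $A\in\mathbb W_\xi$ (with $\sup\varnothing=0$). *)

theory Defs
  imports Main
begin

section \<open>Ordinals\<close>

text \<open>
  HOL has no type of all ordinals. The type \<open>'c ordinal\<close> consists of the order types of the
  well-orders on subsets of \<open>'c\<close>, i.e. of all ordinals below the cardinal successor of \<open>|'c|\<close>.
  By \<open>bdd_above_ordinal\<close> below, for infinite \<open>'c\<close> every \<open>'c\<close>-indexed family of such ordinals has
  an upper bound in the type, so that such suprema are the true ones.
\<close>

quotient_type 'c ordinal = "'c rel" / partial: "\<lambda>r s. (r, s) \<in> ordIso"
proof (rule part_equivpI)
  show "\<exists>r::'c rel. (r, r) \<in> ordIso"
    using ordIso_reflexive[OF card_of_Well_order] by blast
  show "symp (\<lambda>r s::'c rel. (r, s) \<in> ordIso)"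
    by (auto intro: sympI ordIso_symmetric)
  show "transp (\<lambda>r s::'c rel. (r, s) \<in> ordIso)"
    by (auto intro: transpI ordIso_transitive)
qed

lemma ordinal_cases:
  obtains r :: "'c rel" where "(r, r) \<in> ordIso" "a = abs_ordinal r"
proof
  show "(rep_ordinal a, rep_ordinal a) \<in> ordIso"
    using Quotient3_rep_reflp[OF Quotient3_ordinal] .
  show "a = abs_ordinal (rep_ordinal a)"
    using Quotient3_abs_rep[OF Quotient3_ordinal] by (rule sym)
qed

lemma ordIso_Well_order: "(r, s) \<in> ordIso \<Longrightarrow> Well_order r \<and> Well_order s"
  by (simp add: ordIso_def)

instantiation ordinal :: (type) wellorder
begin

lift_definition less_eq_ordinal :: "'c ordinal \<Rightarrow> 'c ordinal \<Rightarrow> bool"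
  is "\<lambda>r s. (r, s) \<in> ordLeq"
  by (meson ordIso_ordLeq_trans ordIso_symmetric ordLeq_ordIso_trans)

lift_definition less_ordinal :: "'c ordinal \<Rightarrow> 'c ordinal \<Rightarrow> bool"
  is "\<lambda>r s. (r, s) \<in> ordLess"
  by (meson ordIso_ordLess_trans ordIso_symmetric ordLess_ordIso_trans)

instance
proof
  fix x y z :: "'c ordinal"
  show "x < y \<longleftrightarrow> x \<le> y \<and> \<not> y \<le> x"
    by transfer (use ordIso_Well_order ordLess_imp_ordLeq not_ordLess_ordLeq
      not_ordLeq_iff_ordLess in blast)
  show "x \<le> x"
    by transfer (rule ordIso_imp_ordLeq)
  show "x \<le> y \<Longrightarrow> y \<le> z \<Longrightarrow> x \<le> z"
    by transfer (rule ordLeq_transitive)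
  show "x \<le> y \<Longrightarrow> y \<le> x \<Longrightarrow> x = y"
    by transfer (simp add: ordIso_iff_ordLeq)
  show "x \<le> y \<or> y \<le> x"
    by transfer (use ordIso_Well_order ordLeq_total in blast)
next
  fix P :: "'c ordinal \<Rightarrow> bool" and a
  assume *: "\<And>x. (\<And>y. y < x \<Longrightarrow> P y) \<Longrightarrow> P x"
  have "(r, r) \<in> ordIso \<Longrightarrow> P (abs_ordinal r)" for r :: "'c rel"
  proof (induction r rule: wf_induct_rule[OF wf_ordLess])
    case (1 r)
    show ?case
    proof (rule *)
      fix y assume y: "y < abs_ordinal r"
      obtain s where s: "(s, s) \<in> ordIso" "y = abs_ordinal s"
        by (rule ordinal_cases)
      with y 1(2) have "(s, r) \<in> ordLess"
        by (simp add: less_ordinal.abs_eq)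
      then show "P y" using 1(1) s by blast
    qed
  qed
  then show "P a" by (metis ordinal_cases)
qed

end

instantiation ordinal :: (type) conditionally_complete_linorder
begin

definition inf_ordinal :: "'c ordinal \<Rightarrow> 'c ordinal \<Rightarrow> 'c ordinal" where
  "inf_ordinal = min"

definition sup_ordinal :: "'c ordinal \<Rightarrow> 'c ordinal \<Rightarrow> 'c ordinal" where
  "sup_ordinal = max"

definition Inf_ordinal :: "'c ordinal set \<Rightarrow> 'c ordinal" where
  "Inf_ordinal X = (LEAST a. a \<in> X)"

definition Sup_ordinal :: "'c ordinal set \<Rightarrow> 'c ordinal" where
  "Sup_ordinal X = (LEAST b. \<forall>a\<in>X. a \<le> b)"

instance
proof
  fix X :: "'c ordinal set" and x z
  show "Inf X \<le> x" if "x \<in> X"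
    unfolding Inf_ordinal_def using that by (rule Least_le)
  show "z \<le> Inf X" if "X \<noteq> {}" "\<And>x. x \<in> X \<Longrightarrow> z \<le> x"
    unfolding Inf_ordinal_def using that by (metis LeastI ex_in_conv)
  show "x \<le> Sup X" if "x \<in> X" "bdd_above X"
    using that LeastI_ex[of "\<lambda>b. \<forall>a\<in>X. a \<le> b"] unfolding Sup_ordinal_def bdd_above_def by blast
  show "Sup X \<le> z" if "\<And>x. x \<in> X \<Longrightarrow> x \<le> z"
    unfolding Sup_ordinal_def using that by (auto intro: Least_le)
qed (auto simp: inf_ordinal_def sup_ordinal_def)

end

lemma Sup_empty_ordinal: "Sup {} \<le> (a :: 'c ordinal)"
  by (simp add: Sup_ordinal_def Least_le)

definition osuc :: "'c ordinal \<Rightarrow> 'c ordinal" where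
  "osuc a = (LEAST b. a < b)"

lemma ordinal_below:
  assumes "(r, r) \<in> ordIso"
  shows "{..<abs_ordinal r} = (\<lambda>x. abs_ordinal (Restr r (underS r x))) ` Field r"
proof (intro equalityI subsetI)
  have W: "Well_order r" using assms ordIso_Well_order by blast
  fix b assume b: "b \<in> {..<abs_ordinal r}"
  obtain s where s: "(s, s) \<in> ordIso" "b = abs_ordinal s"
    by (rule ordinal_cases)
  with b assms have "(s, r) \<in> ordLess" by (simp add: less_ordinal.abs_eq)
  then obtain x where x: "x \<in> Field r" "(s, Restr r (underS r x)) \<in> ordIso"
    using ordLess_iff_ordIso_Restr[OF W] s(1) ordIso_Well_order by blast
  then have "abs_ordinal s = abs_ordinal (Restr r (underS r x))"
    by (intro Quotient3_rel_abs[OF Quotient3_ordinal])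
  then show "b \<in> (\<lambda>x. abs_ordinal (Restr r (underS r x))) ` Field r"
    using s(2) x(1) by blast
next
  have W: "Well_order r" using assms ordIso_Well_order by blast
  fix b assume "b \<in> (\<lambda>x. abs_ordinal (Restr r (underS r x))) ` Field r"
  then obtain x where x: "x \<in> Field r" "b = abs_ordinal (Restr r (underS r x))" by blast
  with W assms underS_Restr_ordLess[OF W, of x] show "b \<in> {..<abs_ordinal r}"
    by (auto simp: less_ordinal.abs_eq ordIso_reflexive Well_order_Restr)
qed

lemma no_surj_ordinal: "\<not> surj (g :: 'c \<Rightarrow> 'c ordinal)"
proof
  assume g: "surj g"
  define s where "s = {(a :: 'c ordinal, b). a \<le> b}"
  have Fs: "Field s = UNIV" by (auto simp: s_def Field_def)
  have "s - Id = {(a, b). a < b}" by (auto simp: s_def)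
  then have "wf (s - Id)" by (simp only: wf)
  moreover have "refl_on (Field s) s" "trans s" "antisym s" "total_on (Field s) s"
    unfolding Fs by (auto simp: s_def refl_on_def trans_def antisym_def total_on_def)
  ultimately have Ws: "Well_order s"
    by (simp add: well_order_on_def linear_order_on_def partial_order_on_def preorder_on_def Fs)
  define h where "h = inv g"
  have h: "inj h" unfolding h_def using g by (rule surj_imp_inj_inv)
  define r where "r = dir_image s h"
  have sr: "(s, r) \<in> ordIso"
    unfolding r_def using dir_image_ordIso[OF Ws] h Fs by simp
  then have rr: "(r, r) \<in> ordIso" using ordIso_reflexive ordIso_Well_order by blast
  obtain f where f: "embed s r f"
    using sr by (auto simp: ordIso_def iso_def)
  have W: "Well_order r" using sr ordIso_Well_order by blast
  define F where "F a = abs_ordinal (Restr r (underS r (f a)))" for a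
  have fF: "f a \<in> Field r" for a using embed_in_Field[OF f] Fs by blast
  have lt: "F a < abs_ordinal r" for a
    using ordinal_below[OF rr] fF[of a] unfolding F_def by blast
  have mono: "F a < F b" if ab: "a < b" for a b
  proof -
    have inj: "inj f" using embed_inj_on[OF Ws f] Fs by simp
    have fr: "(f a, f b) \<in> r"
      using embed_compat[OF f] ab unfolding compat_def s_def by auto
    moreover have "f a \<noteq> f b" using inj ab by (auto dest: injD)
    ultimately have "f a \<in> underS r (f b)" by (auto simp: underS_def)
    moreover have "f a \<notin> underS r (f a)" by (simp add: underS_def)
    moreover have "underS r (f a) \<subseteq> underS r (f b)"
      using underS_incl_iff[of r "f a" "f b"] W fF fr by (simp add: well_order_on_def)
    ultimately have "underS r (f a) \<subset> underS r (f b)" by blast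
    moreover have "wo_rel.ofilter r (underS r (f a))" "wo_rel.ofilter r (underS r (f b))"
      using W by (simp_all add: wo_rel_def wo_rel.underS_ofilter)
    ultimately have "(Restr r (underS r (f a)), Restr r (underS r (f b))) \<in> ordLess"
      using ofilter_subset_ordLess[OF W] by blast
    then show ?thesis unfolding F_def
      by (subst less_ordinal.abs_eq) (simp_all add: W ordIso_reflexive Well_order_Restr)
  qed
  have "a \<le> F a" for a
  proof (induction a rule: less_induct)
    case (less a)
    show ?case
    proof (rule ccontr)
      assume "\<not> a \<le> F a"
      then have "F a < a" by simp
      then show False using less[of "F a"] mono[of "F a" a] by simp
    qed
  qed
  from this[of "abs_ordinal r"] lt[of "abs_ordinal r"] show False by simp
qed

lemma bdd_above_ordinal:
  assumes inf: "infinite (UNIV :: 'c set)"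
  shows "\<exists>b. \<forall>x. (f :: 'c \<Rightarrow> 'c ordinal) x < b"
proof (rule ccontr)
  assume "\<nexists>b. \<forall>x. f x < b"
  then have *: "\<exists>x. b \<le> f x" for b by (simp add: not_less)
  define k where "k a x = (let r = rep_ordinal a in abs_ordinal (Restr r (underS r x)))"
    for a :: "'c ordinal" and x
  have k: "{..<a} \<subseteq> range (k a)" for a
  proof -
    have "(rep_ordinal a, rep_ordinal a) \<in> ordIso" "abs_ordinal (rep_ordinal a) = a"
      using Quotient3_rep_reflp[OF Quotient3_ordinal] Quotient3_abs_rep[OF Quotient3_ordinal] .
    then have "{..<a} = k a ` Field (rep_ordinal a)"
      using ordinal_below[of "rep_ordinal a"] by (simp add: k_def Let_def)
    then show ?thesis by simp (rule image_mono, rule subset_UNIV)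
  qed
  define G where "G = (\<lambda>(x, y, z). if x = y then f z else k (f z) y)"
  have G: "b \<in> range G" for b
  proof -
    obtain x where x: "b \<le> f x" using * by blast
    show ?thesis
    proof (cases "b = f x")
      case True
      then show ?thesis by (intro range_eqI[of _ _ "(x, x, x)"]) (simp add: G_def)
    next
      case False
      with x have "b \<in> {..<f x}" by simp
      with k[of "f x"] obtain y where "b = k (f x) y" by blast
      moreover from ex_new_if_finite[OF inf finite.insertI[OF finite.emptyI], of y] obtain w where "w \<notin> {y}"
        by (rule exE)
      ultimately show ?thesis by (intro range_eqI[of _ _ "(w, y, x)"]) (simp add: G_def)
    qed
  qed
  have "(card_of (UNIV :: 'c set), card_of (UNIV :: ('c \<times> 'c) set)) \<in> ordIso"
    using ordIso_symmetric[OF card_of_Times_same_infinite[OF inf]] by (simp only: UNIV_Times_UNIV)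
  then obtain e :: "'c \<Rightarrow> 'c \<times> 'c" where "bij e"
    unfolding card_of_ordIso[symmetric] by (rule exE)
  then have e: "surj e" by (rule bij_is_surj)
  have "surj (\<lambda>x. G (fst (e x), e (snd (e x))))"
  proof (unfold surj_def, intro allI)
    fix b
    obtain x y z where b: "b = G (x, y, z)" using G[of b] by auto
    obtain v where v: "(y, z) = e v" using e by (rule surjE)
    obtain u where u: "(x, v) = e u" using e by (rule surjE)
    show "\<exists>u. b = G (fst (e u), e (snd (e u)))"
      by (rule exI[of _ u]) (simp add: b u[symmetric] v[symmetric])
  qed
  with no_surj_ordinal show False by (rule notE)
qed


section \<open>The Reflection Calculus\<close>

text \<open>
  Modalities are taken from an arbitrary well-ordered type \<open>'a\<close>, which plays the role of an
  initial segment of the ordinals. Only \<^emph>\<open>set-sized\<close> initial segments can be represented, but this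
  loses nothing: by \<open>RC_map_rc\<close> below, derivability does not depend on the segment, and
  everything derivable from a formula has its modalities in any segment containing those of
  that formula.
\<close>

datatype 'a rc =
    RTop (\<open>\<^bold>\<top>\<close>)
  | RConj "'a rc" "'a rc" (infixr \<open>\<^bold>\<and>\<close> 70)
  | RDia 'a "'a rc" (\<open>\<langle>_\<rangle> _\<close> [0, 75] 75)

inductive RC :: "'a::wellorder rc \<Rightarrow> 'a rc \<Rightarrow> bool" (infix \<open>\<turnstile>\<close> 50) where
  refl: "\<phi> \<turnstile> \<phi>"
| top: "\<phi> \<turnstile> \<^bold>\<top>"
| conj1: "\<phi> \<^bold>\<and> \<psi> \<turnstile> \<phi>"
| conj2: "\<phi> \<^bold>\<and> \<psi> \<turnstile> \<psi>"
| dia_trans: "\<langle>\<alpha>\<rangle> \<langle>\<alpha>\<rangle> \<phi> \<turnstile> \<langle>\<alpha>\<rangle> \<phi>"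
| dia_mono: "\<alpha> < \<beta> \<Longrightarrow> \<langle>\<beta>\<rangle> \<phi> \<turnstile> \<langle>\<alpha>\<rangle> \<phi>"
| dia_conj: "\<alpha> < \<beta> \<Longrightarrow> \<langle>\<beta>\<rangle> \<phi> \<^bold>\<and> \<langle>\<alpha>\<rangle> \<psi> \<turnstile> \<langle>\<beta>\<rangle> (\<phi> \<^bold>\<and> \<langle>\<alpha>\<rangle> \<psi>)"
| cut: "\<phi> \<turnstile> \<psi> \<Longrightarrow> \<psi> \<turnstile> \<chi> \<Longrightarrow> \<phi> \<turnstile> \<chi>"
| conjI: "\<phi> \<turnstile> \<psi> \<Longrightarrow> \<phi> \<turnstile> \<chi> \<Longrightarrow> \<phi> \<turnstile> \<psi> \<^bold>\<and> \<chi>"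
| nec: "\<phi> \<turnstile> \<psi> \<Longrightarrow> \<langle>\<alpha>\<rangle> \<phi> \<turnstile> \<langle>\<alpha>\<rangle> \<psi>"

lemma RC_map_rc:
  fixes f :: "'a::wellorder \<Rightarrow> 'b::wellorder"
  assumes f: "strict_mono f" and seg: "\<And>x y. y \<le> f x \<Longrightarrow> y \<in> range f"
  shows "map_rc f \<phi> \<turnstile> \<Psi> \<longleftrightarrow> (\<exists>\<psi>. \<Psi> = map_rc f \<psi> \<and> \<phi> \<turnstile> \<psi>)"
proof
  have inj: "inj (map_rc f)"
    using f by (intro rc.inj_map strict_mono_imp_inj_on)
  assume "map_rc f \<phi> \<turnstile> \<Psi>"
  then show "\<exists>\<psi>. \<Psi> = map_rc f \<psi> \<and> \<phi> \<turnstile> \<psi>"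
  proof (induction "map_rc f \<phi>" \<Psi> arbitrary: \<phi> rule: RC.induct)
    case refl
    show ?case by (blast intro: RC.refl)
  next
    case top
    show ?case by (rule exI[of _ "\<^bold>\<top>"]) (simp add: RC.top)
  next
    case (conj1 \<phi>1 \<psi>1)
    then show ?case by (cases \<phi>) (auto intro: RC.conj1)
  next
    case (conj2 \<phi>1 \<psi>1)
    then show ?case by (cases \<phi>) (auto intro: RC.conj2)
  next
    case (dia_trans \<alpha> \<phi>1)
    then obtain a \<chi> where \<phi>: "\<phi> = \<langle>a\<rangle> \<chi>" "\<alpha> = f a" "\<langle>\<alpha>\<rangle> \<phi>1 = map_rc f \<chi>" by (cases \<phi>) auto
    moreover from \<phi>(3) obtain b \<chi>' where "\<chi> = \<langle>b\<rangle> \<chi>'" "\<alpha> = f b" "\<phi>1 = map_rc f \<chi>'"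
      by (cases \<chi>) auto
    moreover from this \<phi> have "a = b" using strict_mono_eq[OF f] by simp
    ultimately show ?case by (intro exI[of _ \<chi>]) (auto intro: RC.dia_trans)
  next
    case (dia_mono \<alpha> \<beta> \<phi>1)
    then obtain b \<chi> where \<phi>: "\<phi> = \<langle>b\<rangle> \<chi>" "\<beta> = f b" "\<phi>1 = map_rc f \<chi>" by (cases \<phi>) auto
    then obtain a where a: "\<alpha> = f a" using seg[of \<alpha> b] dia_mono(1) by force
    then have "a < b" using dia_mono(1) \<phi> strict_mono_less[OF f] by simp
    then show ?case using \<phi> a by (intro exI[of _ "\<langle>a\<rangle> \<chi>"]) (auto intro: RC.dia_mono)
  next
    case (dia_conj \<alpha> \<beta> \<phi>1 \<psi>1)
    then obtain c d where \<phi>: "\<phi> = c \<^bold>\<and> d" "\<langle>\<beta>\<rangle> \<phi>1 = map_rc f c" "\<langle>\<alpha>\<rangle> \<psi>1 = map_rc f d"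
      by (cases \<phi>) auto
    from \<phi>(2) obtain b c' where c: "c = \<langle>b\<rangle> c'" "\<beta> = f b" "\<phi>1 = map_rc f c'" by (cases c) auto
    from \<phi>(3) obtain a d' where d: "d = \<langle>a\<rangle> d'" "\<alpha> = f a" "\<psi>1 = map_rc f d'" by (cases d) auto
    have "a < b" using dia_conj(1) c d strict_mono_less[OF f] by simp
    then show ?case using \<phi> c d
      by (intro exI[of _ "\<langle>b\<rangle> (c' \<^bold>\<and> \<langle>a\<rangle> d')"]) (auto intro: RC.dia_conj)
  next
    case (cut \<psi> \<chi>)
    then obtain p where p: "\<psi> = map_rc f p" "\<phi> \<turnstile> p" by blast
    with cut(4) obtain q where "\<chi> = map_rc f q" "p \<turnstile> q" by blast
    then show ?case using RC.cut[OF p(2)] by blast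
  next
    case (conjI \<psi> \<chi>)
    then obtain p q where "\<psi> = map_rc f p" "\<phi> \<turnstile> p" "\<chi> = map_rc f q" "\<phi> \<turnstile> q" by blast
    then show ?case by (intro exI[of _ "p \<^bold>\<and> q"]) (auto intro: RC.conjI)
  next
    case (nec \<phi>1 \<psi> \<alpha>)
    then obtain a \<chi> where \<phi>: "\<phi> = \<langle>a\<rangle> \<chi>" "\<alpha> = f a" "\<phi>1 = map_rc f \<chi>" by (cases \<phi>) auto
    then obtain p where "\<psi> = map_rc f p" "\<chi> \<turnstile> p" using nec(2) by blast
    then show ?case using \<phi> by (intro exI[of _ "\<langle>a\<rangle> p"]) (auto intro: RC.nec)
  qed
next
  assume "\<exists>\<psi>. \<Psi> = map_rc f \<psi> \<and> \<phi> \<turnstile> \<psi>"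
  then obtain \<psi> where "\<Psi> = map_rc f \<psi>" "\<phi> \<turnstile> \<psi>" by blast
  moreover from \<open>\<phi> \<turnstile> \<psi>\<close> have "map_rc f \<phi> \<turnstile> map_rc f \<psi>"
  proof induction
    case (cut \<phi> \<psi> \<chi>)
    then show ?case by (meson RC.cut)
  qed (auto intro: RC.refl RC.top RC.conj1 RC.conj2 RC.dia_trans RC.dia_mono RC.dia_conj RC.conjI
      RC.nec strict_monoD[OF f])
  ultimately show "map_rc f \<phi> \<turnstile> \<Psi>" by simp
qed


section \<open>Worms and their order types\<close>

inductive_set worms :: "'a rc set" where
  "\<^bold>\<top> \<in> worms"
| "A \<in> worms \<Longrightarrow> \<langle>\<alpha>\<rangle> A \<in> worms"

definition worms_ge :: "'a::wellorder \<Rightarrow> 'a rc set" where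
  "worms_ge \<xi> = {A \<in> worms. \<forall>\<alpha> \<in> set_rc A. \<xi> \<le> \<alpha>}"

definition worm_less :: "'a::wellorder \<Rightarrow> 'a rc \<Rightarrow> 'a rc \<Rightarrow> bool" where
  "worm_less \<xi> A B \<longleftrightarrow> B \<turnstile> \<langle>\<xi>\<rangle> A"

definition worm_rel :: "'a::wellorder rc set \<Rightarrow> 'a \<Rightarrow> 'a rc rel" where
  "worm_rel W \<xi> = {(B, A). B \<in> W \<and> A \<in> W \<and> worm_less \<xi> B A}"

text \<open>
  The values \<open>worm_rank W \<xi> A\<close> are meaningful for \<open>A \<in> W\<close> only. They are taken in \<open>'a rc ordinal\<close>,
  where by \<open>bdd_above_ordinal\<close> any family indexed by formulas is bounded.
\<close>

definition worm_rank :: "'a::wellorder rc set \<Rightarrow> 'a \<Rightarrow> 'a rc \<Rightarrow> 'a rc ordinal" where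
  "worm_rank W \<xi> =
     wfrec (worm_rel W \<xi>) (\<lambda>r A. Sup {osuc (r B) |B. B \<in> W \<and> worm_less \<xi> B A})"

definition worm_o :: "'a::wellorder \<Rightarrow> 'a rc \<Rightarrow> 'a rc ordinal" where
  "worm_o \<xi> = worm_rank worms \<xi>"

definition worm_o_check :: "'a::wellorder \<Rightarrow> 'a rc \<Rightarrow> 'a rc ordinal" where
  "worm_o_check \<xi> = worm_rank (worms_ge \<xi>) \<xi>"

lemma worm_rank_rec:
  assumes "wf (worm_rel W \<xi>)" and "A \<in> W"
  shows "worm_rank W \<xi> A = Sup {osuc (worm_rank W \<xi> B) |B. B \<in> W \<and> worm_less \<xi> B A}"
proof -
  have "cut (worm_rank W \<xi>) (worm_rel W \<xi>) A B = worm_rank W \<xi> B"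
    if "B \<in> W" "worm_less \<xi> B A" for B
    using that assms(2) by (simp add: cut_def worm_rel_def)
  then have *: "{osuc (cut (worm_rank W \<xi>) (worm_rel W \<xi>) A B) |B. B \<in> W \<and> worm_less \<xi> B A} =
      {osuc (worm_rank W \<xi> B) |B. B \<in> W \<and> worm_less \<xi> B A}"
    by (intro Collect_cong ex_cong1) auto
  have "worm_rank W \<xi> A =
      Sup {osuc (cut (worm_rank W \<xi>) (worm_rel W \<xi>) A B) |B. B \<in> W \<and> worm_less \<xi> B A}"
    unfolding worm_rank_def by (rule wfrec[OF assms(1)])
  then show ?thesis unfolding * .
qed

lemma less_osuc: "a < osuc a" if "infinite (UNIV :: 'c set)" for a :: "'c ordinal"
  unfolding osuc_def using bdd_above_ordinal[OF that, of "\<lambda>_. a"] by (auto intro: LeastI_ex)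

lemma infinite_UNIV_rc: "infinite (UNIV :: 'a rc set)"
proof
  assume "finite (UNIV :: 'a rc set)"
  moreover have "inj (\<lambda>A :: 'a rc. A \<^bold>\<and> \<^bold>\<top>)" by (auto intro: injI)
  ultimately have "surj (\<lambda>A :: 'a rc. A \<^bold>\<and> \<^bold>\<top>)" by (rule finite_UNIV_inj_surj)
  then obtain A :: "'a rc" where "\<^bold>\<top> = A \<^bold>\<and> \<^bold>\<top>" by (rule surjE)
  then show False by simp
qed

end

theory Submission
  imports Defs
begin

text \<open>
  Replacing every subformula \<open>\<langle>\<alpha>\<rangle> \<psi>\<close> with \<open>\<alpha> < \<xi>\<close> by \<open>\<^bold>\<top>\<close> maps each axiom and rule of
  \<open>RC\<close> to a derivable one. On worms this projection is the \<open>\<xi>\<close>-head, so it retracts \<open>\<bbbW>\<close> onto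
  \<open>\<bbbW>\<^sub>\<xi>\<close>, and since \<open>\<phi>\<close> proves its projection, it maps the \<open><\<^sub>\<xi>\<close>-predecessors of a worm
  exactly onto the \<open><\<^sub>\<xi>\<close>-predecessors in \<open>\<bbbW>\<^sub>\<xi>\<close> of its head. Such a map preserves ranks.
\<close>

text \<open>Induction on the derivation of the first value: the two functions used at
  \<open>x\<close> agree on all predecessors, so admissibility gives equal values.\<close>

lemma wfrec_rel_unique:
  assumes F: "adm_wf R F" and "wfrec_rel R F x u" "wfrec_rel R F x v"
  shows "u = v"
  using assms(2,3)
proof (induction arbitrary: v)
  case (wfrecI x g)
  from wfrecI.prems obtain g' where "\<forall>z. (z, x) \<in> R \<longrightarrow> wfrec_rel R F z (g' z)" "v = F g' x"
    by (blast elim: wfrec_rel.cases)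
  with wfrecI.IH F show ?case unfolding adm_wf_def by blast
qed

text \<open>
  Neither relation has to be well-founded: \<open>wfrec_rel\<close> has no value outside the accessible part,
  so there the \<open>THE\<close> in \<open>wfrec\<close> denotes one fixed element, the same for both relations.
\<close>

lemma wfrec_bisimulation:
  assumes step: "\<And>f g x. x \<in> D \<Longrightarrow> (\<And>y. (y, x) \<in> R \<Longrightarrow> f y = g (h y)) \<Longrightarrow> F f x = G g (h x)"
    and hom: "\<And>x y. x \<in> D \<Longrightarrow> (y, x) \<in> R \<Longrightarrow> y \<in> D \<and> (h y, h x) \<in> S"
    and lift: "\<And>x z. x \<in> D \<Longrightarrow> (z, h x) \<in> S \<Longrightarrow> \<exists>y. (y, x) \<in> R \<and> h y = z"
    and "x \<in> D"
  shows "wfrec R F x = wfrec S G (h x)"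
proof -
  \<comment> \<open>\<open>wfrec\<close> takes the \<open>THE\<close> of \<open>wfrec_rel\<close>
    for these functionals; the cut makes them admissible.\<close>
  define F' where "F' = (\<lambda>f x. F (cut f R x) x)"
  define G' where "G' = (\<lambda>f x. G (cut f S x) x)"
  have step': "F' f x = G' g (h x)"
    if "x \<in> D" "\<And>y. (y, x) \<in> R \<Longrightarrow> f y = g (h y)" for f g x
    unfolding F'_def G'_def using that hom by (intro step) (auto simp: cut_def)
  have F': "wfrec_rel S G' (h x) u" if "wfrec_rel R F' x u" "x \<in> D" for x u
    using that
  proof induction
    case (wfrecI x g)
    \<comment> \<open>\<open>h\<close> may identify points, so \<open>g\<close> cannot simply be
      pushed forward; uniqueness of the values along \<open>S\<close> makes \<open>g'\<close> agree
      with \<open>g\<close> on the predecessors.\<close>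
    define g' where "g' w = (THE v. wfrec_rel S G' w v)" for w
    have g': "wfrec_rel S G' (h y) (g y) \<and> g' (h y) = g y" if "(y, x) \<in> R" for y
    proof
      show *: "wfrec_rel S G' (h y) (g y)"
        using wfrecI that hom by blast
      show "g' (h y) = g y"
        unfolding g'_def using * wfrec_rel_unique[OF adm_lemma, of S G]
        by (intro the_equality) (auto simp: G'_def)
    qed
    then have "wfrec_rel S G' (h x) (G' g' (h x))"
      using lift[OF wfrecI.prems] by (intro wfrec_rel.wfrecI) metis
    then show ?case using step'[OF wfrecI.prems, of g g'] g' by simp
  qed
  have G': "wfrec_rel R F' x u" if "wfrec_rel S G' z u" "x \<in> D" "z = h x" for x z u
    using that
  proof (induction arbitrary: x)
    case (wfrecI z g)
    then have "wfrec_rel R F' x (F' (g \<circ> h) x)"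
      using hom by (intro wfrec_rel.wfrecI) auto
    then show ?case using step'[OF wfrecI.prems(1), of "g \<circ> h" g] wfrecI.prems(2) by simp
  qed
  have "wfrec_rel R F' x = wfrec_rel S G' (h x)"
    using F' G' \<open>x \<in> D\<close> by blast
  then show ?thesis by (simp add: wfrec_def F'_def G'_def)
qed

primrec proj_ge :: "'a::wellorder \<Rightarrow> 'a rc \<Rightarrow> 'a rc" where
  "proj_ge \<xi> \<^bold>\<top> = \<^bold>\<top>"
| "proj_ge \<xi> (\<phi> \<^bold>\<and> \<psi>) = proj_ge \<xi> \<phi> \<^bold>\<and> proj_ge \<xi> \<psi>"
| "proj_ge \<xi> (\<langle>\<alpha>\<rangle> \<phi>) = (if \<xi> \<le> \<alpha> then \<langle>\<alpha>\<rangle> proj_ge \<xi> \<phi> else \<^bold>\<top>)"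

lemma RC_proj_ge: "\<phi> \<turnstile> \<psi> \<Longrightarrow> proj_ge \<xi> \<phi> \<turnstile> proj_ge \<xi> \<psi>"
proof (induction rule: RC.induct)
  case (cut \<phi> \<psi> \<chi>)
  then show ?case by (meson RC.cut)
next
  case (dia_conj \<alpha> \<beta> \<phi> \<psi>)
  have "\<langle>\<beta>\<rangle> \<chi> \<^bold>\<and> \<^bold>\<top> \<turnstile> \<langle>\<beta>\<rangle> (\<chi> \<^bold>\<and> \<^bold>\<top>)" for \<chi> :: "'a rc"
    by (meson RC.cut RC.conj1 RC.nec RC.conjI RC.refl RC.top)
  with dia_conj show ?case by (auto intro: RC.dia_conj RC.top)
qed (auto intro: RC.intros(1-7) RC.conjI RC.nec)

lemma RC_imp_proj_ge: "\<phi> \<turnstile> proj_ge \<xi> \<phi>"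
proof (induction \<phi>)
  case (RConj \<phi> \<psi>)
  then show ?case by (auto intro: RC.conjI RC.cut[OF RC.conj1] RC.cut[OF RC.conj2])
qed (auto intro: RC.top RC.nec)

lemma proj_ge_worms: "A \<in> worms \<Longrightarrow> proj_ge \<xi> A \<in> worms_ge \<xi>"
  by (induction rule: worms.induct) (auto simp: worms_ge_def intro: worms.intros)

lemma proj_ge_ident: "\<forall>\<alpha>\<in>set_rc \<phi>. \<xi> \<le> \<alpha> \<Longrightarrow> proj_ge \<xi> \<phi> = \<phi>"
  by (induction \<phi>) auto

lemma proj_ge_worms_ge: "A \<in> worms_ge \<xi> \<Longrightarrow> proj_ge \<xi> A = A"
  by (simp add: worms_ge_def proj_ge_ident)

text \<open>The modality \<xi> itself survives the projection, so
  \<open>\<langle>\<xi>\<rangle> B\<close> keeps its outer diamond.\<close>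

lemma worm_less_proj_ge: "worm_less \<xi> B A \<Longrightarrow> worm_less \<xi> (proj_ge \<xi> B) (proj_ge \<xi> A)"
  unfolding worm_less_def using RC_proj_ge[of A "\<langle>\<xi>\<rangle> B" \<xi>] by simp

lemma worm_less_proj_geD: "worm_less \<xi> B (proj_ge \<xi> A) \<Longrightarrow> worm_less \<xi> B A"
  unfolding worm_less_def by (rule RC.cut[OF RC_imp_proj_ge])

lemma worm_predecessors_proj_ge:
  assumes "A \<in> worms"
  shows "{C \<in> worms_ge \<xi>. worm_less \<xi> C (proj_ge \<xi> A)} =
    proj_ge \<xi> ` {B \<in> worms. worm_less \<xi> B A}"
proof (intro equalityI subsetI)
  fix C assume C: "C \<in> {C \<in> worms_ge \<xi>. worm_less \<xi> C (proj_ge \<xi> A)}"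
  \<comment> \<open>\<open>C\<close> serves as its own preimage, being fixed by the
    projection.\<close>
  then have "C \<in> {B \<in> worms. worm_less \<xi> B A}"
    by (auto simp: worms_ge_def dest: worm_less_proj_geD)
  then show "C \<in> proj_ge \<xi> ` {B \<in> worms. worm_less \<xi> B A}"
    using C by (intro image_eqI[of _ _ C]) (auto simp: proj_ge_worms_ge)
qed (auto intro: proj_ge_worms worm_less_proj_ge)

text \<open>Stated for all worms because the recursion for \<open>worm_o\<close> leaves
  \<open>worms_ge \<xi>\<close>: a predecessor of a worm there may contain modalities below
  \<xi>.\<close>

lemma worm_o_eq_worm_o_check_proj_ge:
  assumes "A \<in> worms"
  shows "worm_o \<xi> A = worm_o_check \<xi> (proj_ge \<xi> A)"
  unfolding worm_o_def worm_o_check_def worm_rank_def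
proof (rule wfrec_bisimulation[where D = worms])
  fix f g :: "'a rc \<Rightarrow> 'a rc ordinal" and A :: "'a rc"
  assume A: "A \<in> worms" and fg: "\<And>B. (B, A) \<in> worm_rel worms \<xi> \<Longrightarrow> f B = g (proj_ge \<xi> B)"
  have "{osuc (f B) |B. B \<in> worms \<and> worm_less \<xi> B A} =
      (\<lambda>B. osuc (f B)) ` {B \<in> worms. worm_less \<xi> B A}"
    by blast
  \<comment> \<open>The supremum sees only the set of values, so predecessors with the same
    projection may be merged.\<close>
  also have "\<dots> = (\<lambda>C. osuc (g C)) ` proj_ge \<xi> ` {B \<in> worms. worm_less \<xi> B A}"
    unfolding image_image using A by (intro image_cong) (auto simp: fg worm_rel_def)
  also have "\<dots> = {osuc (g C) |C. C \<in> worms_ge \<xi> \<and> worm_less \<xi> C (proj_ge \<xi> A)}"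
    unfolding worm_predecessors_proj_ge[OF A, symmetric] by blast
  finally show "Sup {osuc (f B) |B. B \<in> worms \<and> worm_less \<xi> B A} =
      Sup {osuc (g C) |C. C \<in> worms_ge \<xi> \<and> worm_less \<xi> C (proj_ge \<xi> A)}"
    by simp
next
  fix A B :: "'a rc"
  assume "A \<in> worms" "(B, A) \<in> worm_rel worms \<xi>"
  then show "B \<in> worms \<and> (proj_ge \<xi> B, proj_ge \<xi> A) \<in> worm_rel (worms_ge \<xi>) \<xi>"
    by (auto simp: worm_rel_def intro: proj_ge_worms worm_less_proj_ge)
next
  fix A C :: "'a rc"
  assume A: "A \<in> worms" and "(C, proj_ge \<xi> A) \<in> worm_rel (worms_ge \<xi>) \<xi>"
  then have "C \<in> {C \<in> worms_ge \<xi>. worm_less \<xi> C (proj_ge \<xi> A)}"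
    by (simp add: worm_rel_def)
  then show "\<exists>B. (B, A) \<in> worm_rel worms \<xi> \<and> proj_ge \<xi> B = C"
    unfolding worm_predecessors_proj_ge[OF A] using A by (auto simp: worm_rel_def)
qed (fact assms)

theorem corollary4p12:
  fixes \<xi> :: "'a::wellorder" and A :: "'a rc"
  assumes "A \<in> worms_ge \<xi>"
  shows "worm_o \<xi> A = worm_o_check \<xi> A"
  using assms worm_o_eq_worm_o_check_proj_ge[of A \<xi>]
  by (simp add: proj_ge_worms_ge) (simp add: worms_ge_def)

end
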